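(* Let $G$ be a connected graph with no isolated vertices, let $n=|V(G)|$, and let $k$ be an integer with $1\le k\le n$. The following are equivalent: (1) $G$ is $(n-k)$-connected. (2) There exists $A\in\mathcal{S}(G)$ with $k=\operatorname{rank}(A)=\operatorname{spark}(A)-1$. (3) There exists $A\in\mathcal{S}(G)$ with $k=\operatorname{rank}(A)$ and such that for any vertex $v$ of $G$ the columns of $A$ corresponding to $v$ and its non-neighbors are linearly independent. (4) There exists $A\in\mathcal{S}(G)$ with $k=\operatorname{rank}(A)$ and such that for any vertex $v$ of $G$ the columns of $A$ corresponding to the non-neighbors of $v$ are linearly independent.
   Context: Graphs are finite, simple and undirected. For a graph $G$ with vertices $v_1,\dots,v_n$, $\mathcal{S}(G)$ is the set of real symmetric $n\times n$ matrices $A=[a_{ij}]$ such that for $i\neq j$, $a_{ij}\neq 0$ if and only if $v_iv_j$ is an edge of $G$ (diagonal entries are unrestricted); columns of $A$ are indexed by the vertices of $G$. The non-neighbors of a vertex $v$ are the vertices other than $v$ that are not adjacent to $v$. The spark of a real symmetric $n\times n$ matrix $A$, $\operatorname{spark}(A)$, is the smallest integer $s$ such that some $s$ columns of $A$ are linearly dependent (equivalently the minimum size of the support of a nonzero null vector of $A$); if $A$ is nonsingular, $\operatorname{spark}(A)=n+1$. The vertex connectivity $\kappa(G)$ is the minimum size of a set of vertices whose deletion disconnects $G$, with the convention $\kappa(K_n)=n-1$ for complete graphs. A graph is $m$-connected if $\kappa(G)\ge m$. *)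

theory Defs
  imports "HOL-Analysis.Analysis"
begin

text \<open>
  A graph has as vertices all elements of a finite type \<open>'n\<close>, so that its matrices have type
  \<open>real^'n^'n\<close> and its order is \<open>CARD('n)\<close>; it is given by its adjacency relation.
\<close>

definition simple_graph :: "('n::finite \<Rightarrow> 'n \<Rightarrow> bool) \<Rightarrow> bool" where
  "simple_graph adj \<longleftrightarrow> symp adj \<and> irreflp adj"

definition complete_graph :: "('n::finite \<Rightarrow> 'n \<Rightarrow> bool) \<Rightarrow> bool" where
  "complete_graph adj \<longleftrightarrow> (\<forall>u v. u \<noteq> v \<longrightarrow> adj u v)"

definition isolated_vertex :: "('n::finite \<Rightarrow> 'n \<Rightarrow> bool) \<Rightarrow> 'n \<Rightarrow> bool" where
  "isolated_vertex adj v \<longleftrightarrow> (\<forall>w. \<not> adj v w)"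

definition non_neighbors :: "('n::finite \<Rightarrow> 'n \<Rightarrow> bool) \<Rightarrow> 'n \<Rightarrow> 'n set" where
  "non_neighbors adj v = {w. w \<noteq> v \<and> \<not> adj v w}"

text \<open>Connectedness of the subgraph induced on \<open>W\<close>; the null graph counts as connected.\<close>

definition connected_induced :: "('n::finite \<Rightarrow> 'n \<Rightarrow> bool) \<Rightarrow> 'n set \<Rightarrow> bool" where
  "connected_induced adj W \<longleftrightarrow>
     (\<forall>u\<in>W. \<forall>v\<in>W. (\<lambda>x y. x \<in> W \<and> y \<in> W \<and> adj x y)\<^sup>*\<^sup>* u v)"

definition connected_graph :: "('n::finite \<Rightarrow> 'n \<Rightarrow> bool) \<Rightarrow> bool" where
  "connected_graph adj \<longleftrightarrow> connected_induced adj UNIV"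

text \<open>
  The minimum exists for every non-complete graph: deleting all vertices other than
  two distinct non-adjacent ones disconnects it.
\<close>

definition vertex_connectivity :: "('n::finite \<Rightarrow> 'n \<Rightarrow> bool) \<Rightarrow> nat" where
  "vertex_connectivity adj =
     (if complete_graph adj then CARD('n) - 1
      else (LEAST m. \<exists>S. card S = m \<and> \<not> connected_induced adj (- S)))"

definition m_connected :: "nat \<Rightarrow> ('n::finite \<Rightarrow> 'n \<Rightarrow> bool) \<Rightarrow> bool" where
  "m_connected m adj \<longleftrightarrow> m \<le> vertex_connectivity adj"

definition sym_matrices :: "('n::finite \<Rightarrow> 'n \<Rightarrow> bool) \<Rightarrow> (real^'n^'n) set" where
  "sym_matrices adj =
     {A. transpose A = A \<and> (\<forall>i j. i \<noteq> j \<longrightarrow> (A $ i $ j \<noteq> 0 \<longleftrightarrow> adj i j))}"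

text \<open>
  Linear independence of the columns with indices in \<open>S\<close> as a family: two equal columns with
  different indices are dependent, hence the injectivity requirement.
\<close>

definition columns_independent :: "real^'n^'n \<Rightarrow> 'n::finite set \<Rightarrow> bool" where
  "columns_independent A S \<longleftrightarrow>
     inj_on (\<lambda>j. column j A) S \<and> independent ((\<lambda>j. column j A) ` S)"

definition spark :: "real^'n^'n \<Rightarrow> nat" where
  "spark A =
     (if invertible A then CARD('n::finite) + 1
      else (LEAST s. \<exists>S. card S = s \<and> \<not> columns_independent A S))"

end

theory Submission
  imports Defs
begin

text \<open>
  The hard implication is from connectivity to a matrix, and it is a theorem of Lovasz, Saks and
  Schrijver: an \<open>(n - k)\<close>-connected graph has an orthogonal representation by vectors in a
  \<open>k\<close>-dimensional space \<open>W\<close> (nonadjacent distinct vertices get orthogonal vectors) such that any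
  \<open>k\<close> vectors are independent and adjacent vertices get non-orthogonal vectors. Its Gram matrix
  lies in \<open>sym_matrices adj\<close>, has rank \<open>k\<close>, and any \<open>k\<close> of its columns are independent, so its
  spark is \<open>k + 1\<close> (\<open>exists_sym_matrix_with_independent_columns\<close>, \<open>spark_eq_Suc_rank\<close>).
  
  The representation is found one vertex at a time, by perturbation. Call a representation of the
  subgraph induced on \<open>T\<close> generic if it has the two nondegeneracy properties above. The key fact,
  \<open>generic_dense\<close>, says that a representation of \<open>T\<close> which is generic on \<open>T - {v}\<close> can be
  approximated by representations that are generic on \<open>T\<close>. Given this, one extends a generic
  representation of \<open>T - {v}\<close> by the zero vector at \<open>v\<close> and perturbs. If \<open>T\<close> has at most \<open>k\<close>
  vertices, the density is linear algebra (\<open>generic_dense_small\<close>). If \<open>T\<close> is larger, deleting the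
  vertices outside \<open>T\<close> cannot disconnect the graph, so \<open>T\<close> induces a connected subgraph; and for
  adjacent \<open>v\<close> and \<open>w\<close> the induction hypothesis for \<open>T - {w}\<close> turns genericity on \<open>T - {v}\<close> into
  genericity on \<open>T - {w}\<close> (\<open>generic_dense_adjacent\<close>). Walking along paths reaches every vertex,
  and genericity on all the sets \<open>T - {w}\<close> is genericity on \<open>T\<close>.
  
  The other implications are rank arguments for arbitrary, possibly indefinite, symmetric
  matrices. If any \<open>k = rank A\<close> columns are independent, then \<open>k\<close> columns that all vanish in the row
  of \<open>v\<close> would force that row to vanish; hence a vertex has fewer than \<open>k\<close> non-neighbors and the
  columns of the vertex and its non-neighbors are independent
  (\<open>card_closed_non_neighbors_le_rank\<close>). Conversely, if the columns of the non-neighbors of every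
  vertex are independent and the graph induced on \<open>T\<close> splits into parts \<open>C\<close> and \<open>D\<close> without edges
  between them, then \<open>card C + card D \<le> rank A\<close> (\<open>card_separated_le_rank\<close>), so sets of more than
  \<open>k\<close> vertices induce connected subgraphs.
\<close>

section \<open>Independent families of vectors\<close>

definition independent_family :: "('i \<Rightarrow> 'a::real_vector) \<Rightarrow> 'i set \<Rightarrow> bool" where
  "independent_family b S \<longleftrightarrow> inj_on b S \<and> independent (b ` S)"

lemma columns_independent_iff_family:
  "columns_independent A S \<longleftrightarrow> independent_family (\<lambda>j. column j A) S"
  by (simp add: columns_independent_def independent_family_def)

lemma independent_family_mono:
  "independent_family b S \<Longrightarrow> T \<subseteq> S \<Longrightarrow> independent_family b T"
  unfolding independent_family_def by (meson image_mono independent_mono inj_on_subset)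

lemma independent_family_iff:
  assumes "finite S"
  shows "independent_family b S \<longleftrightarrow>
    (\<forall>c. (\<Sum>i\<in>S. c i *\<^sub>R b i) = 0 \<longrightarrow> (\<forall>i\<in>S. c i = 0))"
proof
  assume ind: "independent_family b S"
  hence inj: "inj_on b S" and indep: "independent (b ` S)"
    by (auto simp: independent_family_def)
  show "\<forall>c. (\<Sum>i\<in>S. c i *\<^sub>R b i) = 0 \<longrightarrow> (\<forall>i\<in>S. c i = 0)"
  proof (intro allI impI ballI)
    fix c i assume 0: "(\<Sum>i\<in>S. c i *\<^sub>R b i) = 0" and i: "i \<in> S"
    define u where "u = c \<circ> inv_into S b"
    have "(\<Sum>v\<in>b ` S. u v *\<^sub>R v) = (\<Sum>i\<in>S. c i *\<^sub>R b i)"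
      by (simp add: sum.reindex[OF inj] u_def inj)
    hence "\<forall>v\<in>b ` S. u v = 0"
      using indep 0 assms by (auto simp: dependent_finite)
    thus "c i = 0" using i inj by (auto simp: u_def)
  qed
next
  assume *: "\<forall>c. (\<Sum>i\<in>S. c i *\<^sub>R b i) = 0 \<longrightarrow> (\<forall>i\<in>S. c i = 0)"
  have inj: "inj_on b S"
  proof (rule inj_onI, rule ccontr)
    fix i j assume ij: "i \<in> S" "j \<in> S" "b i = b j" "i \<noteq> j"
    define c where "c = (\<lambda>l. if l = i then 1 else if l = j then -1 else (0::real))"
    have "(\<Sum>l\<in>S. c l *\<^sub>R b l) = (\<Sum>l\<in>{i,j}. c l *\<^sub>R b l)"
      by (rule sum.mono_neutral_right) (use assms ij in \<open>auto simp: c_def\<close>)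
    also have "\<dots> = 0" using ij by (simp add: c_def)
    finally have "c i = 0" using * ij(1) by blast
    thus False by (simp add: c_def)
  qed
  moreover have "independent (b ` S)"
  proof -
    have "u (b i) = 0" if "(\<Sum>v\<in>b ` S. u v *\<^sub>R v) = 0" "i \<in> S" for u i
    proof -
      have "(\<Sum>i\<in>S. u (b i) *\<^sub>R b i) = 0"
        using that(1) by (simp add: sum.reindex[OF inj])
      thus ?thesis using spec[OF *, of "\<lambda>i. u (b i)"] that(2) by blast
    qed
    thus ?thesis using assms by (auto simp: dependent_finite)
  qed
  ultimately show "independent_family b S" by (simp add: independent_family_def)
qed

lemma independent_family_card_le_dim:
  fixes b :: "'i \<Rightarrow> 'a::euclidean_space"
  assumes "independent_family b S" "b ` S \<subseteq> V"
  shows "card S \<le> dim V"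
  using assms independent_card_le_dim[of "b ` S" V] card_image[of b S]
  by (auto simp: independent_family_def)

text \<open>
  A linear functional with the prescribed values on an independent family extends to the whole
  space, where it is the inner product with a vector; only the projection of that vector to the
  span of the family affects the values.
\<close>

lemma exists_dual_vector:
  fixes b :: "'i \<Rightarrow> 'a::euclidean_space"
  assumes "independent_family b S"
  obtains a where "a \<in> span (b ` S)" "\<And>i. i \<in> S \<Longrightarrow> a \<bullet> b i = f i"
proof -
  have inj: "inj_on b S" and indep: "independent (b ` S)"
    using assms by (auto simp: independent_family_def)
  obtain g where g: "linear g" "\<forall>v\<in>b ` S. g v = (f \<circ> inv_into S b) v"
    using linear_independent_extend[OF indep, of "f \<circ> inv_into S b"] by blast
  have gi: "g (b i) = f i" if "i \<in> S" for i
    using g(2) that inj by auto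
  define r where "r = adjoint g (1::real)"
  have r: "v \<bullet> r = g v" for v
    using adjoint_works[OF g(1), of v 1] by (simp add: r_def)
  obtain p q where pq: "p \<in> span (b ` S)" "\<And>w. w \<in> span (b ` S) \<Longrightarrow> orthogonal q w" "r = p + q"
    using orthogonal_subspace_decomp_exists[of "b ` S" r] by metis
  have "p \<bullet> b i = f i" if "i \<in> S" for i
  proof -
    have "q \<bullet> b i = 0" using pq(2)[of "b i"] that by (simp add: orthogonal_def span_base)
    thus ?thesis using r[of "b i"] gi[OF that] pq(3)
      by (simp add: inner_commute[of "b i"] inner_add_left)
  qed
  thus ?thesis using pq(1) that by blast
qed

text \<open>
  The quantitative form of independence that survives perturbation. The map that sends
  coefficients \<open>c\<close> on \<open>S\<close> to \<open>\<Sum>c i *\<^sub>R x $ i\<close> is injective, hence bounded below on a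
  finite-dimensional space, and moving each vector by less than \<open>B\<close> costs at most
  \<open>B * (\<Sum>i\<in>S. \<bar>c i\<bar>)\<close>.
\<close>

lemma independent_family_uniform_lower_bound:
  fixes x :: "'a::euclidean_space ^ 'n::finite"
  assumes "independent_family (($) x) S"
  obtains B d where "B > 0" "d > 0"
    "\<And>y c. dist y x < d \<Longrightarrow> B * (\<Sum>i\<in>S. \<bar>c i\<bar>) \<le> norm (\<Sum>i\<in>S. c i *\<^sub>R y $ i)"
proof -
  \<comment> \<open>The second component makes the map injective on all of \<open>real^'n\<close>, not just on
    coefficient vectors supported in \<open>S\<close>.\<close>
  define f :: "real^'n \<Rightarrow> 'a \<times> (real^'n)" where
    "f = (\<lambda>c. (\<Sum>i\<in>S. c $ i *\<^sub>R x $ i, \<chi> i. if i \<in> S then 0 else c $ i))"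
  have lin: "linear f"
    unfolding f_def
    by (rule linearI) (auto simp: scaleR_left_distrib sum.distrib scaleR_sum_right vec_eq_iff)
  have "inj f"
  proof (rule linear_injective_0[THEN iffD2, OF lin], intro allI impI)
    fix c assume 0: "f c = 0"
    hence "c $ i = 0" if "i \<in> S" for i
      using assms that independent_family_iff[of S "($) x"] by (simp add: f_def zero_prod_def)
    moreover have "c $ i = 0" if "i \<notin> S" for i
      using 0 that by (simp add: f_def zero_prod_def vec_eq_iff) metis
    ultimately show "c = 0" by (metis vec_eq_iff zero_index)
  qed
  then obtain B0 where B0: "B0 > 0" "\<And>c. B0 * norm c \<le> norm (f c)"
    using linear_inj_bounded_below_pos[OF lin] by blast
  define N where "N = real CARD('n)"
  have N: "N > 0" by (simp add: N_def)
  \<comment> \<open>\<open>N\<close> pays for passing from the Euclidean norm of the coefficients to their absolute sum;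
    half of the resulting bound is given up to the perturbation.\<close>
  define B where "B = B0 / (2 * N)"
  have B: "B > 0" using B0 N by (simp add: B_def)
  have "B * (\<Sum>i\<in>S. \<bar>c i\<bar>) \<le> norm (\<Sum>i\<in>S. c i *\<^sub>R y $ i)" if y: "dist y x < B" for y c
  proof -
    define c' :: "real^'n" where "c' = (\<chi> i. if i \<in> S then c i else 0)"
    have "\<bar>c i\<bar> \<le> norm c'" if "i \<in> S" for i
      using component_le_norm_cart[of c' i] that by (simp add: c'_def)
    hence "(\<Sum>i\<in>S. \<bar>c i\<bar>) \<le> real (card S) * norm c'"
      by (rule sum_bounded_above)
    also have "\<dots> \<le> N * norm c'"
      unfolding N_def by (intro mult_right_mono) (auto intro: card_mono)
    finally have "B0 / N * (\<Sum>i\<in>S. \<bar>c i\<bar>) \<le> B0 / N * (N * norm c')"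
      using B0 N by (intro mult_left_mono) auto
    also have "\<dots> = B0 * norm c'" using N by simp
    also have "\<dots> \<le> norm (f c')" by (rule B0)
    also have "f c' = (\<Sum>i\<in>S. c i *\<^sub>R x $ i, 0)"
      by (auto simp: f_def c'_def vec_eq_iff)
    finally have x: "2 * B * (\<Sum>i\<in>S. \<bar>c i\<bar>) \<le> norm (\<Sum>i\<in>S. c i *\<^sub>R x $ i)"
      by (simp add: norm_Pair B_def)
    have "norm ((\<Sum>i\<in>S. c i *\<^sub>R x $ i) - (\<Sum>i\<in>S. c i *\<^sub>R y $ i))
        = norm (\<Sum>i\<in>S. c i *\<^sub>R (x $ i - y $ i))"
      by (simp add: scaleR_diff_right sum_subtractf)
    also have "\<dots> \<le> (\<Sum>i\<in>S. \<bar>c i\<bar> * B)"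
    proof (rule sum_norm_le)
      fix i
      have "norm (x $ i - y $ i) \<le> B"
        using dist_vec_nth_le[of y i x] y by (simp add: dist_norm norm_minus_commute)
      thus "norm (c i *\<^sub>R (x $ i - y $ i)) \<le> \<bar>c i\<bar> * B"
        by (simp add: mult_left_mono)
    qed
    also have "\<dots> = B * (\<Sum>i\<in>S. \<bar>c i\<bar>)" by (simp add: sum_distrib_left mult.commute)
    finally show ?thesis
      using x norm_triangle_ineq2[of "\<Sum>i\<in>S. c i *\<^sub>R x $ i" "\<Sum>i\<in>S. c i *\<^sub>R y $ i"]
      by linarith
  qed
  with B that[of B B] show ?thesis by blast
qed

lemma open_independent_family:
  "open {x :: 'a::euclidean_space ^ 'n::finite. independent_family (($) x) S}"
  unfolding open_dist
proof safe
  fix x :: "'a^'n" assume "independent_family (($) x) S"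
  then obtain B d where Bd: "B > 0" "d > 0"
    "\<And>y c. dist y x < d \<Longrightarrow> B * (\<Sum>i\<in>S. \<bar>c i\<bar>) \<le> norm (\<Sum>i\<in>S. c i *\<^sub>R y $ i)"
    using independent_family_uniform_lower_bound by metis
  have "independent_family (($) y) S" if y: "dist y x < d" for y
    unfolding independent_family_iff[OF finite]
  proof (intro allI impI)
    fix c assume "(\<Sum>i\<in>S. c i *\<^sub>R y $ i) = 0"
    hence "B * (\<Sum>i\<in>S. \<bar>c i\<bar>) \<le> 0" using Bd(3)[OF y, of c] by simp
    hence "(\<Sum>i\<in>S. \<bar>c i\<bar>) \<le> 0" using Bd(1) by (simp add: mult_le_0_iff)
    hence "(\<Sum>i\<in>S. \<bar>c i\<bar>) = 0" by (simp add: sum_nonneg antisym)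
    thus "\<forall>i\<in>S. c i = 0" by (simp add: sum_nonneg_eq_0_iff)
  qed
  thus "\<exists>e>0. \<forall>y. dist y x < e \<longrightarrow> y \<in> {x. independent_family (($) x) S}"
    using Bd(2) by auto
qed

text \<open>
  Orthogonality constraints can be followed continuously as long as the constraining vectors
  are independent: when the family moves from \<open>x\<close> to \<open>y\<close>, the vector \<open>u\<close> is replaced by its
  component orthogonal to the new family. The removed component \<open>p\<close> satisfies
  \<open>(norm p)\<^sup>2 = p \<bullet> u\<close>, which only sees the differences \<open>y $ i - x $ i\<close>, while the lower bound
  above keeps the coefficients of \<open>p\<close> under control.
\<close>

lemma orthogonal_vector_perturbation:
  fixes x :: "'a::euclidean_space ^ 'n::finite"
  assumes ind: "independent_family (($) x) S"
    and u: "u \<in> W" "\<And>i. i \<in> S \<Longrightarrow> u \<bullet> x $ i = 0"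
    and W: "subspace W" and e: "e > 0"
  obtains d where "d > 0"
    "\<And>y. dist y x < d \<Longrightarrow> (\<And>i. i \<in> S \<Longrightarrow> y $ i \<in> W) \<Longrightarrow>
       \<exists>u'\<in>W. dist u' u < e \<and> (\<forall>i\<in>S. u' \<bullet> y $ i = 0)"
proof -
  obtain B d where Bd: "B > 0" "d > 0"
    "\<And>y c. dist y x < d \<Longrightarrow> B * (\<Sum>i\<in>S. \<bar>c i\<bar>) \<le> norm (\<Sum>i\<in>S. c i *\<^sub>R y $ i)"
    using independent_family_uniform_lower_bound[OF ind] by metis
  define d' where "d' = min d (B * e / (norm u + 1))"
  have nu: "norm u + 1 > 0" by (simp add: add_nonneg_pos)
  have d': "d' > 0" using Bd e nu by (simp add: d'_def)
  have "\<exists>u'\<in>W. dist u' u < e \<and> (\<forall>i\<in>S. u' \<bullet> y $ i = 0)"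
    if y: "dist y x < d'" "\<And>i. i \<in> S \<Longrightarrow> y $ i \<in> W" for y
  proof -
    obtain p q where pq: "p \<in> span (($) y ` S)" "\<And>w. w \<in> span (($) y ` S) \<Longrightarrow> orthogonal q w" "u = p + q"
      using orthogonal_subspace_decomp_exists[of "($) y ` S" u] by metis
    have "span (($) y ` S) \<subseteq> W" using y(2) W by (intro span_minimal) auto
    hence qW: "q \<in> W" using pq(1,3) u(1) W subspace_diff[of W u p] by auto
    have q0: "q \<bullet> y $ i = 0" if "i \<in> S" for i
      using pq(2)[of "y $ i"] that by (auto simp: orthogonal_def span_base)
    obtain c where c: "p = (\<Sum>i\<in>S. c i *\<^sub>R y $ i)"
    proof -
      have "\<exists>c. p = (\<Sum>i\<in>S. c i *\<^sub>R y $ i)" using pq(1)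
      proof (induction rule: span_induct_alt)
        case base show ?case by (rule exI[of _ "\<lambda>_. 0"]) simp
      next
        case (step a v w)
        then obtain c j where c: "w = (\<Sum>i\<in>S. c i *\<^sub>R y $ i)" and j: "j \<in> S" "v = y $ j" by auto
        have "a *\<^sub>R v + w = (\<Sum>i\<in>S. (c i + (if i = j then a else 0)) *\<^sub>R y $ i)"
          using j by (simp add: scaleR_left_distrib sum.distrib c if_distrib[of "\<lambda>t. t *\<^sub>R _"] cong: if_cong)
        thus ?case by (rule exI[of _ "\<lambda>i. c i + (if i = j then a else 0)"])
      qed
      thus ?thesis using that by blast
    qed
    have "norm p ^ 2 = p \<bullet> u"
      using pq(1,3) pq(2)[of p] by (simp add: inner_add_right orthogonal_def inner_commute power2_norm_eq_inner)
    also have "\<dots> = (\<Sum>i\<in>S. c i * (u \<bullet> (y $ i - x $ i)))"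
      unfolding c inner_sum_left using u(2) by (simp add: inner_diff_right inner_commute)
    also have "\<dots> \<le> (\<Sum>i\<in>S. \<bar>c i\<bar> * (norm u * dist y x))"
    proof (rule sum_mono)
      fix i
      have "\<bar>u \<bullet> (y $ i - x $ i)\<bar> \<le> norm u * norm (y $ i - x $ i)" by (rule Cauchy_Schwarz_ineq2)
      also have "\<dots> \<le> norm u * dist y x"
        using dist_vec_nth_le[of y i x] by (intro mult_left_mono) (auto simp: dist_norm)
      finally have "\<bar>c i\<bar> * \<bar>u \<bullet> (y $ i - x $ i)\<bar> \<le> \<bar>c i\<bar> * (norm u * dist y x)"
        by (intro mult_left_mono) auto
      thus "c i * (u \<bullet> (y $ i - x $ i)) \<le> \<bar>c i\<bar> * (norm u * dist y x)"
        using abs_ge_self[of "c i * (u \<bullet> (y $ i - x $ i))"] unfolding abs_mult by linarith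
    qed
    also have "\<dots> = (\<Sum>i\<in>S. \<bar>c i\<bar>) * (norm u * dist y x)" by (simp add: sum_distrib_right)
    also have "\<dots> \<le> (norm p / B) * (norm u * dist y x)"
      using Bd(3)[of y c] y(1) Bd(1) unfolding c[symmetric]
      by (intro mult_right_mono) (auto simp: d'_def field_simps)
    finally have "norm p * norm p \<le> norm p * (norm u * dist y x / B)"
      by (simp add: power2_eq_square)
    hence "norm p \<le> norm u * dist y x / B \<or> norm p = 0"
      by (metis mult_le_cancel_left_pos norm_ge_zero order_le_less)
    hence "norm p \<le> norm u * dist y x / B"
      using Bd(1) by auto
    also have "\<dots> \<le> (norm u + 1) * dist y x / B"
      using Bd(1) by (intro divide_right_mono mult_right_mono) auto
    also have "\<dots> < (norm u + 1) * (B * e / (norm u + 1)) / B"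
      using Bd(1) y(1) nu by (intro divide_strict_right_mono mult_strict_left_mono) (auto simp: d'_def)
    also have "\<dots> = e" using Bd(1) nu by simp
    finally have "dist q u < e" by (simp add: pq(3) dist_norm)
    thus ?thesis using qW q0 by blast
  qed
  with d' that show ?thesis by blast
qed

section \<open>Density of generic orthogonal representations\<close>

lemma dist_replace_component:
  fixes x :: "'a::real_inner ^ 'n::finite"
  shows "dist (\<chi> i. if i = v then u else x $ i) x = dist u (x $ v)"
proof -
  have "(\<chi> i. if i = v then u else x $ i) - x = axis v (u - x $ v)"
    by (simp add: vec_eq_iff axis_def)
  thus ?thesis by (simp add: dist_norm norm_eq_sqrt_inner inner_axis_axis)
qed

text \<open>
  The dimension of \<open>W\<close> plays the role of \<open>k\<close>. Working in a subspace instead of a whole type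
  lets the dimension be an arbitrary number. The last assumption is the form in which
  \<open>(n - k)\<close>-connectivity enters; unlike the connectivity number, it passes to induced subgraphs,
  as the inductions below require.
\<close>

locale connectivity_and_space =
  fixes adj :: "'n::finite \<Rightarrow> 'n \<Rightarrow> bool" and W :: "'a::euclidean_space set"
  assumes simple: "simple_graph adj"
    and subspace: "subspace W"
    and dim_pos: "0 < dim W"
    and large_connected: "\<And>T. dim W < card T \<Longrightarrow> connected_induced adj T"
begin

text \<open>
  Vectors with index outside \<open>T\<close> are constrained only to lie in \<open>W\<close>, so that representations of
  all induced subgraphs live in one metric space and restriction is set inclusion.
\<close>

definition orthogonal_reps :: "'n set \<Rightarrow> ('a^'n) set" where
  "orthogonal_reps T = {x. (\<forall>i. x $ i \<in> W) \<and>
     (\<forall>i\<in>T. \<forall>j\<in>T. i \<noteq> j \<longrightarrow> \<not> adj i j \<longrightarrow> x $ i \<bullet> x $ j = 0)}"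

text \<open>
  General position together with nonzero inner products along the edges. This is an open
  condition.
\<close>

definition generic :: "'n set \<Rightarrow> ('a^'n) set" where
  "generic T = {x. (\<forall>S\<subseteq>T. card S \<le> dim W \<longrightarrow> independent_family (($) x) S) \<and>
     (\<forall>i\<in>T. \<forall>j\<in>T. adj i j \<longrightarrow> x $ i \<bullet> x $ j \<noteq> 0)}"

lemma adj_sym: "adj i j \<Longrightarrow> adj j i"
  using simple by (auto simp: simple_graph_def dest: sympD)

lemma adj_irrefl: "\<not> adj i i"
  using simple by (auto simp: simple_graph_def irreflp_def)

lemma orthogonal_reps_mono: "T \<subseteq> T' \<Longrightarrow> orthogonal_reps T' \<subseteq> orthogonal_reps T"
  unfolding orthogonal_reps_def by blast

lemma generic_mono: "T \<subseteq> T' \<Longrightarrow> generic T' \<subseteq> generic T"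
  unfolding generic_def by blast

lemma generic_cong:
  assumes "x \<in> generic T" "\<And>i. i \<in> T \<Longrightarrow> y $ i = x $ i"
  shows "y \<in> generic T"
proof -
  have "independent_family (($) y) S" if "S \<subseteq> T" "card S \<le> dim W" for S
  proof -
    have "inj_on (($) y) S = inj_on (($) x) S" "($) y ` S = ($) x ` S"
      using assms(2) that(1) by (auto intro!: inj_on_cong image_cong)
    thus ?thesis using assms(1) that by (auto simp: generic_def independent_family_def)
  qed
  thus ?thesis using assms by (auto simp: generic_def)
qed

lemma open_generic: "open (generic T)"
proof -
  have "generic T = (\<Inter>S\<in>{S. S \<subseteq> T \<and> card S \<le> dim W}. {x. independent_family (($) x) S}) \<inter>
    (\<Inter>i\<in>T. \<Inter>j\<in>{j\<in>T. adj i j}. {x. x $ i \<bullet> x $ j \<noteq> 0})"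
    unfolding generic_def by auto
  moreover have "open {x :: 'a^'n. x $ i \<bullet> x $ j \<noteq> 0}" for i j
    by (intro open_Collect_neq continuous_intros)
  ultimately show ?thesis
    by (auto intro!: open_Int open_INT open_independent_family)
qed

lemma span_representation:
  "x \<in> orthogonal_reps T \<Longrightarrow> span (($) x ` S) \<subseteq> W"
  using subspace by (intro span_minimal) (auto simp: orthogonal_reps_def)

text \<open>
  If \<open>v\<close> had more non-neighbors, it would be isolated in a large, hence connected, induced
  subgraph. The bound makes the constraints that the vectors of the non-neighbors impose on
  the vector of \<open>v\<close> independent at any generic representation.
\<close>

lemma card_closed_non_neighbors: "card (insert v (non_neighbors adj v)) \<le> dim W"
proof (rule ccontr)
  let ?N = "insert v (non_neighbors adj v)"
  assume "\<not> card ?N \<le> dim W"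
  hence large: "dim W < card ?N" by simp
  have "?N \<noteq> {v}"
  proof
    assume "?N = {v}"
    hence "card ?N = 1" by (simp only: card.insert finite.emptyI card.empty empty_iff) simp
    thus False using large dim_pos by simp
  qed
  then obtain w where w: "w \<in> ?N" "w \<noteq> v" by blast
  have "(\<lambda>x y. x \<in> ?N \<and> y \<in> ?N \<and> adj x y)\<^sup>*\<^sup>* v w"
    using large_connected[OF large] w by (auto simp: connected_induced_def)
  then obtain y where "y \<in> ?N" "adj v y"
    using w(2) by (auto elim: converse_rtranclpE)
  thus False using adj_irrefl by (auto simp: non_neighbors_def)
qed

text \<open>
  Up to \<open>dim W\<close> vertices there is room to move: the vectors of \<open>T - {v}\<close> are independent and do
  not span \<open>W\<close>. So there is a direction \<open>h\<close> that is orthogonal to the vectors of the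
  non-neighbors of \<open>v\<close>, not orthogonal to those of its neighbors, and outside the span of all
  of them. Adding a small multiple of \<open>h\<close> to the vector of \<open>v\<close> respects orthogonality, and
  all but finitely many multiples give a generic representation.
\<close>

lemma generic_dense_small:
  assumes T: "card T \<le> dim W" and v: "v \<in> T"
  shows "orthogonal_reps T \<inter> generic (T - {v}) \<subseteq> closure (orthogonal_reps T \<inter> generic T)"
proof
  fix x assume x: "x \<in> orthogonal_reps T \<inter> generic (T - {v})"
  define S where "S = T - {v}"
  have cS: "card S < card T" unfolding S_def by (rule card_Diff1_less[OF finite v])
  have indS: "independent_family (($) x) S"
    using x cS T by (auto simp: generic_def S_def)
  have sW: "span (($) x ` S) \<subseteq> W" using x span_representation by blast
  have "dim (($) x ` S) \<le> card S"
    using dim_le_card'[of "($) x ` S"] card_image_le[of S "($) x"] by simp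
  hence "dim (span (($) x ` S)) \<noteq> dim W" using cS T by simp
  hence "span (($) x ` S) \<noteq> W" by metis
  hence "span (($) x ` S) \<subset> span W" using sW subspace by (simp add: span_eq_iff[THEN iffD2] psubsetI)
  then obtain z where z: "z \<noteq> 0" "z \<in> span W" "\<And>y. y \<in> span (($) x ` S) \<Longrightarrow> orthogonal z y"
    using orthogonal_to_subspace_exists_gen by metis
  have zW: "z \<in> W" using z(2) subspace by (simp add: span_eq_iff[THEN iffD2])
  have zS: "x $ i \<bullet> z = 0" if "i \<in> S" for i
    using z(3)[of "x $ i"] that by (auto simp: orthogonal_def span_base inner_commute)
  obtain a where a: "a \<in> span (($) x ` S)"
      "\<And>i. i \<in> S \<Longrightarrow> a \<bullet> x $ i = (if adj v i then 1 else 0)"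
    using exists_dual_vector[OF indS, of "\<lambda>i. if adj v i then 1 else 0"] by blast
  define h where "h = a + z"
  have hW: "h \<in> W" using a(1) sW zW subspace by (auto simp: h_def subspace_add)
  have hS: "h \<bullet> x $ i = (if adj v i then 1 else 0)" if "i \<in> S" for i
    using a(2)[OF that] zS[OF that] by (simp add: h_def inner_add_left inner_commute[of z])
  have hz: "h \<bullet> z = z \<bullet> z"
    using z(3)[OF a(1)] by (simp add: h_def inner_add_left orthogonal_def inner_commute[of z a])
  show "x \<in> closure (orthogonal_reps T \<inter> generic T)"
    unfolding closure_approachable
  proof (intro allI impI)
    fix e :: real assume e: "e > 0"
    \<comment> \<open>The multiples at which some edge at \<open>v\<close> gets inner product zero, or at which the new vector
      becomes orthogonal to \<open>z\<close> and so may fall into the span of the others.\<close>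
    define bad where "bad = (\<lambda>i. - (x $ v \<bullet> x $ i)) ` S \<union> {- (x $ v \<bullet> z) / (z \<bullet> z)}"
    define e' where "e' = e / (norm h + 1)"
    have nh: "norm h + 1 > 0" by (simp add: add_nonneg_pos)
    have e': "e' > 0" using e nh by (simp add: e'_def)
    have "finite bad" by (simp add: bad_def)
    hence "infinite ({0<..<e'} - bad)" using e' by (intro Diff_infinite_finite) auto
    then obtain t where t: "t \<in> {0<..<e'}" "t \<notin> bad" by (metis DiffE finite.emptyI equals0I)
    define y :: "'a^'n" where "y = (\<chi> i. if i = v then x $ v + t *\<^sub>R h else x $ i)"
    have yS: "y $ i = x $ i" if "i \<in> S" for i using that by (simp add: y_def S_def)
    have yv: "y $ v = x $ v + t *\<^sub>R h" by (simp add: y_def)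
    have yvi: "y $ v \<bullet> y $ i = x $ v \<bullet> x $ i + (if adj v i then t else 0)" if "i \<in> S" for i
      using hS[OF that] by (simp add: yv yS[OF that] inner_add_left)
    have "dist y x = \<bar>t\<bar> * norm h"
      unfolding y_def dist_replace_component by (simp add: dist_norm)
    also have "\<dots> \<le> t * (norm h + 1)" using t(1) by simp
    also have "\<dots> < e' * (norm h + 1)" using t(1) nh by (intro mult_strict_right_mono) auto
    also have "\<dots> = e" using nh by (simp add: e'_def)
    finally have dist: "dist y x < e" .
    have rep: "y \<in> orthogonal_reps T"
    proof -
      have "y $ i \<in> W" for i
        using x hW subspace by (auto simp: y_def orthogonal_reps_def subspace_add subspace_scale)
      moreover have v0: "y $ v \<bullet> y $ i = 0" if "i \<in> T" "i \<noteq> v" "\<not> adj v i" for i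
      proof -
        have "x $ v \<bullet> x $ i = 0" using x v that by (auto simp: orthogonal_reps_def)
        thus ?thesis using yvi[of i] that by (simp add: S_def)
      qed
      moreover have "y $ i \<bullet> y $ j = 0" if "i \<in> T" "j \<in> T" "i \<noteq> j" "\<not> adj i j" for i j
      proof (cases "i = v \<or> j = v")
        case True
        thus ?thesis
        proof
          assume "i = v"
          thus ?thesis using v0[OF that(2)] that by simp
        next
          assume j: "j = v"
          have "y $ v \<bullet> y $ i = 0" using v0[OF that(1)] that(3,4) adj_sym j by blast
          thus ?thesis using j by (simp only: inner_commute)
        qed
      next
        case False
        thus ?thesis using x that yS[of i] yS[of j] by (auto simp: orthogonal_reps_def S_def)
      qed
      ultimately show ?thesis by (auto simp: orthogonal_reps_def)
    qed
    have yvz: "y $ v \<bullet> z \<noteq> 0"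
    proof
      assume "y $ v \<bullet> z = 0"
      hence "x $ v \<bullet> z + t * (z \<bullet> z) = 0" by (simp add: yv inner_add_left hz)
      hence "t = - (x $ v \<bullet> z) / (z \<bullet> z)" using z(1) by (simp add: field_simps)
      thus False using t(2) by (simp add: bad_def)
    qed
    have indT: "independent_family (($) y) T"
      unfolding independent_family_iff[OF finite]
    proof (intro allI impI)
      fix c assume 0: "(\<Sum>i\<in>T. c i *\<^sub>R y $ i) = 0"
      have split: "(\<Sum>i\<in>T. c i *\<^sub>R y $ i) = c v *\<^sub>R y $ v + (\<Sum>i\<in>S. c i *\<^sub>R x $ i)"
        using v yS by (simp add: sum.remove[of T v] S_def)
      have "0 = (\<Sum>i\<in>T. c i *\<^sub>R y $ i) \<bullet> z" using 0 by simp
      also have "\<dots> = c v * (y $ v \<bullet> z)"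
        unfolding split by (simp add: inner_add_left inner_sum_left zS)
      finally have cv: "c v = 0" using yvz by simp
      hence "(\<Sum>i\<in>S. c i *\<^sub>R x $ i) = 0" using 0 split by simp
      hence "\<forall>i\<in>S. c i = 0" using indS by (simp add: independent_family_iff)
      thus "\<forall>i\<in>T. c i = 0" using cv by (auto simp: S_def)
    qed
    have edge_v: "y $ v \<bullet> y $ i \<noteq> 0" if "i \<in> T" "adj v i" for i
    proof -
      have i: "i \<in> S" using that adj_irrefl by (auto simp: S_def)
      have "t \<noteq> - (x $ v \<bullet> x $ i)" using t(2) i unfolding bad_def by blast
      thus ?thesis using yvi[OF i] that(2) by simp
    qed
    have "y $ i \<bullet> y $ j \<noteq> 0" if "i \<in> T" "j \<in> T" "adj i j" for i j
    proof (cases "i = v \<or> j = v")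
      case True
      thus ?thesis
      proof
        assume "i = v"
        thus ?thesis using edge_v[OF that(2)] that by simp
      next
        assume j: "j = v"
        have "y $ v \<bullet> y $ i \<noteq> 0" using edge_v[OF that(1)] that(3) adj_sym j by blast
        thus ?thesis using j by (simp only: inner_commute not_False_eq_True)
      qed
    next
      case False
      thus ?thesis using x that yS[of i] yS[of j] by (auto simp: generic_def S_def)
    qed
    hence "y \<in> generic T"
      using indT independent_family_mono by (auto simp: generic_def)
    thus "\<exists>y\<in>orthogonal_reps T \<inter> generic T. dist y x < e" using rep dist by blast
  qed
qed

text \<open>
  The exchange step. The vectors of two adjacent vertices do not constrain each other, so the
  one of \<open>w\<close> can be set aside: the rest is made generic by the induction hypothesis for
  \<open>T - {w}\<close>, moving it only slightly, and the vector of \<open>w\<close> then follows. That it can follow is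
  where genericity of \<open>T - {v}\<close> is used: this set contains all non-neighbors of \<open>w\<close> in \<open>T\<close>,
  since \<open>v\<close> is a neighbor.
\<close>

lemma generic_dense_adjacent:
  assumes vw: "v \<in> T" "w \<in> T" "adj v w"
    and IH: "orthogonal_reps (T - {w}) \<inter> generic (T - {w} - {v})
      \<subseteq> closure (orthogonal_reps (T - {w}) \<inter> generic (T - {w}))"
  shows "orthogonal_reps T \<inter> generic (T - {v}) \<subseteq> closure (orthogonal_reps T \<inter> generic (T - {w}))"
proof
  fix x assume x: "x \<in> orthogonal_reps T \<inter> generic (T - {v})"
  have vw': "v \<noteq> w" "adj w v" using vw adj_irrefl adj_sym by auto
  define N where "N = T \<inter> non_neighbors adj w"
  have N: "N \<subseteq> T - {v}" using vw' by (auto simp: N_def non_neighbors_def)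
  have "card N \<le> card (insert w (non_neighbors adj w))"
    by (intro card_mono) (auto simp: N_def)
  hence "card N \<le> dim W" using card_closed_non_neighbors[of w] by simp
  hence ind: "independent_family (($) x) N" using x N by (auto simp: generic_def)
  have xw: "x $ w \<bullet> x $ i = 0" if "i \<in> N" for i
    using x that vw by (auto simp: orthogonal_reps_def N_def non_neighbors_def)
  have xW: "x $ w \<in> W" using x by (auto simp: orthogonal_reps_def)
  have x': "x \<in> closure (orthogonal_reps (T - {w}) \<inter> generic (T - {w}))"
    using x IH orthogonal_reps_mono[of "T - {w}" T] generic_mono[of "T - {w} - {v}" "T - {v}"] by blast
  show "x \<in> closure (orthogonal_reps T \<inter> generic (T - {w}))"
    unfolding closure_approachable
  proof (intro allI impI)
    fix e :: real assume e: "e > 0"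
    \<comment> \<open>One third each for the motion of the constraining family, seen in the whole and again in
      the coordinate \<open>w\<close>, and for the response of the vector at \<open>w\<close>.\<close>
    hence e3: "e / 3 > 0" by simp
    obtain d where d: "d > 0"
      "\<And>y. dist y x < d \<Longrightarrow> (\<And>i. i \<in> N \<Longrightarrow> y $ i \<in> W) \<Longrightarrow>
         \<exists>u\<in>W. dist u (x $ w) < e / 3 \<and> (\<forall>i\<in>N. u \<bullet> y $ i = 0)"
      using orthogonal_vector_perturbation[OF ind xW xw subspace e3] by metis
    have "min d (e / 3) > 0" using d(1) e3 by simp
    then obtain y where y: "y \<in> orthogonal_reps (T - {w})" "y \<in> generic (T - {w})"
        "dist y x < min d (e / 3)"
      using x' unfolding closure_approachable by blast
    have yW: "y $ i \<in> W" for i using y(1) by (auto simp: orthogonal_reps_def)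
    obtain u where u: "u \<in> W" "dist u (x $ w) < e / 3" "\<And>i. i \<in> N \<Longrightarrow> u \<bullet> y $ i = 0"
      using d(2)[of y] y(3) yW by auto
    define y' :: "'a^'n" where "y' = (\<chi> i. if i = w then u else y $ i)"
    have y'w: "y' $ w = u" by (simp add: y'_def)
    have y'i: "y' $ i = y $ i" if "i \<noteq> w" for i using that by (simp add: y'_def)
    have "dist y' x \<le> dist u (y $ w) + dist y x"
      using dist_triangle[of y' x y] by (simp add: y'_def dist_replace_component)
    also have "\<dots> \<le> dist u (x $ w) + dist (y $ w) (x $ w) + dist y x"
      using dist_triangle[of u "y $ w" "x $ w"] by (simp add: dist_commute)
    also have "\<dots> \<le> dist u (x $ w) + dist y x + dist y x"
      using dist_vec_nth_le[of y w x] by simp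
    also have "\<dots> < e" using u(2) y(3) by simp
    finally have dist: "dist y' x < e" .
    have w0: "y' $ w \<bullet> y' $ i = 0" if "i \<in> T" "i \<noteq> w" "\<not> adj w i" for i
      using u(3)[of i] that by (simp add: y'w y'i N_def non_neighbors_def)
    have "y' $ i \<bullet> y' $ j = 0" if "i \<in> T" "j \<in> T" "i \<noteq> j" "\<not> adj i j" for i j
    proof (cases "i = w \<or> j = w")
      case True
      thus ?thesis
      proof
        assume "i = w"
        thus ?thesis using w0[OF that(2)] that by simp
      next
        assume j: "j = w"
        have "y' $ w \<bullet> y' $ i = 0" using w0[OF that(1)] that(3,4) adj_sym j by blast
        thus ?thesis using j by (simp only: inner_commute)
      qed
    next
      case False
      thus ?thesis using y(1) that by (simp add: y'i orthogonal_reps_def)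
    qed
    hence "y' \<in> orthogonal_reps T"
      using yW u(1) by (auto simp: orthogonal_reps_def y'_def)
    moreover have "y' \<in> generic (T - {w})"
      by (rule generic_cong[OF y(2)]) (auto simp: y'i)
    ultimately show "\<exists>y\<in>orthogonal_reps T \<inter> generic (T - {w}). dist y x < e"
      using dist by blast
  qed
qed

text \<open>
  Exchange steps compose along a path in the subgraph induced on \<open>T\<close>.
\<close>

lemma generic_dense_connected:
  assumes adjacent: "\<And>v w. v \<in> T \<Longrightarrow> w \<in> T \<Longrightarrow> adj v w \<Longrightarrow>
      orthogonal_reps T \<inter> generic (T - {v}) \<subseteq> closure (orthogonal_reps T \<inter> generic (T - {w}))"
    and "connected_induced adj T" "v \<in> T" "w \<in> T"
  shows "orthogonal_reps T \<inter> generic (T - {v}) \<subseteq> closure (orthogonal_reps T \<inter> generic (T - {w}))"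
proof -
  let ?X = "orthogonal_reps T" and ?O = "\<lambda>v. generic (T - {v})"
  have "(\<lambda>x y. x \<in> T \<and> y \<in> T \<and> adj x y)\<^sup>*\<^sup>* v w"
    using assms(2-4) by (auto simp: connected_induced_def)
  thus ?thesis
  proof (induction rule: rtranclp_induct)
    case base
    show ?case by (rule closure_subset)
  next
    case (step p q)
    have "?X \<inter> ?O v \<subseteq> closure (?X \<inter> ?O p)" by (rule step.IH)
    also have "\<dots> \<subseteq> closure (closure (?X \<inter> ?O q))"
      using adjacent step.hyps(2) by (intro closure_mono) blast
    finally show ?case by simp
  qed
qed

text \<open>
  A set of at most \<open>dim W\<close> vertices misses a vertex of \<open>T\<close>, and so does an edge unless it is all
  of \<open>T\<close>. In that case \<open>dim W = 1\<close>, and two nonzero vectors on a line are never orthogonal.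
\<close>

lemma generic_of_deletions:
  assumes T: "dim W < card T" and x: "x \<in> orthogonal_reps T"
    and gen: "\<And>w. w \<in> T \<Longrightarrow> x \<in> generic (T - {w})"
  shows "x \<in> generic T"
proof -
  have "independent_family (($) x) S" if S: "S \<subseteq> T" "card S \<le> dim W" for S
  proof -
    have "S \<noteq> T" using T S(2) by auto
    then obtain w where "w \<in> T" "w \<notin> S" using S(1) by blast
    hence "x \<in> generic (T - {w})" "S \<subseteq> T - {w}" using gen S(1) by auto
    thus ?thesis using S(2) unfolding generic_def by blast
  qed
  moreover have "x $ i \<bullet> x $ j \<noteq> 0" if ij: "i \<in> T" "j \<in> T" "adj i j" for i j
  proof (cases "T = {i, j}")
    case False
    then obtain w where "w \<in> T" "w \<notin> {i, j}" using ij(1,2) by auto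
    thus ?thesis using gen[of w] ij unfolding generic_def by blast
  next
    case True
    have ne: "i \<noteq> j" using ij(3) adj_irrefl by auto
    hence dim: "dim W = 1" using T True dim_pos by simp
    have "independent_family (($) x) {i}" "independent_family (($) x) {j}"
      using gen[OF ij(1)] gen[OF ij(2)] True ne dim by (auto simp: generic_def)
    hence nz: "x $ i \<noteq> 0" "x $ j \<noteq> 0"
      by (auto simp: independent_family_def dependent_single)
    show ?thesis
    proof
      assume 0: "x $ i \<bullet> x $ j = 0"
      have "x $ i \<noteq> x $ j" using 0 nz by auto
      moreover have "independent {x $ i, x $ j}"
        using 0 nz by (intro pairwise_orthogonal_independent)
          (auto simp: pairwise_def orthogonal_def inner_commute)
      ultimately have "2 \<le> dim W"
        using independent_card_le_dim[of "{x $ i, x $ j}" W] x by (auto simp: orthogonal_reps_def)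
      thus False using dim by simp
    qed
  qed
  ultimately show ?thesis by (auto simp: generic_def)
qed

text \<open>
  A representation that is generic away from a single vertex is a limit of generic ones. In a
  large \<open>T\<close>, which is connected, the exchange steps lead from \<open>v\<close> to every other vertex \<open>w\<close>: the
  representations that are generic on \<open>T - {w}\<close> are dense in those that are generic on
  \<open>T - {v}\<close>. As they are also relatively open, finitely many of these conditions can be met
  at once, and all of them together mean genericity on \<open>T\<close>.
\<close>

lemma generic_dense:
  "v \<in> T \<Longrightarrow> orthogonal_reps T \<inter> generic (T - {v}) \<subseteq> closure (orthogonal_reps T \<inter> generic T)"
proof (induction "card T" arbitrary: T v rule: less_induct)
  case less
  let ?X = "orthogonal_reps T" and ?O = "\<lambda>v. generic (T - {v})"
  show ?case
  proof (cases "card T \<le> dim W")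
    case True
    thus ?thesis using generic_dense_small less.prems by blast
  next
    case False
    hence large: "dim W < card T" by simp
    have adjacent: "?X \<inter> ?O v \<subseteq> closure (?X \<inter> ?O w)" if "v \<in> T" "w \<in> T" "adj v w" for v w
    proof (rule generic_dense_adjacent[OF that])
      have "v \<in> T - {w}" using that adj_irrefl by auto
      thus "orthogonal_reps (T - {w}) \<inter> generic (T - {w} - {v})
          \<subseteq> closure (orthogonal_reps (T - {w}) \<inter> generic (T - {w}))"
        using less.hyps[of "T - {w}" v] that(2) by (simp add: card_Diff1_less del: card_Diff_insert)
    qed
    have all: "?X \<inter> ?O v \<subseteq> closure (?X \<inter> ?O w)" if "w \<in> T" for w
      using generic_dense_connected[OF adjacent large_connected[OF large] less.prems that] by blast
    have "F \<subseteq> T \<Longrightarrow> ?X \<inter> ?O v \<subseteq> closure (?X \<inter> (?O v \<inter> (\<Inter>w\<in>F. ?O w)))" for F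
    proof (induction F rule: finite_induct[OF finite])
      case 1
      show ?case using closure_subset[of "?X \<inter> ?O v"] by simp
    next
      case (2 w F)
      let ?U = "?O v \<inter> (\<Inter>w\<in>F. ?O w)"
      have openU: "open ?U" by (intro open_Int open_INT finite ballI open_generic)
      have "?X \<inter> ?O v \<subseteq> closure (?X \<inter> ?U)" using 2 by blast
      also have "\<dots> \<subseteq> closure (closure (?X \<inter> (?U \<inter> ?O w)))"
      proof (rule closure_mono)
        have "?X \<inter> ?U \<subseteq> ?U \<inter> closure (?X \<inter> ?O w)" using all[of w] 2 by blast
        also have "\<dots> \<subseteq> closure (?U \<inter> (?X \<inter> ?O w))"
          by (rule open_Int_closure_subset[OF openU])
        also have "?U \<inter> (?X \<inter> ?O w) = ?X \<inter> (?U \<inter> ?O w)" by blast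
        finally show "?X \<inter> ?U \<subseteq> closure (?X \<inter> (?U \<inter> ?O w))" .
      qed
      also have "closure (closure (?X \<inter> (?U \<inter> ?O w))) = closure (?X \<inter> (?O v \<inter> (\<Inter>w\<in>insert w F. ?O w)))"
        by (simp add: Int_ac)
      finally show ?case .
    qed
    from this[of T] have "?X \<inter> ?O v \<subseteq> closure (?X \<inter> (?O v \<inter> (\<Inter>w\<in>T. ?O w)))" by simp
    also have "\<dots> \<subseteq> closure (?X \<inter> generic T)"
      using generic_of_deletions[OF large] by (intro closure_mono) auto
    finally show ?thesis .
  qed
qed

text \<open>
  The zero vector for a new vertex satisfies every orthogonality constraint; it is not generic,
  but density supplies a generic representation next to it.
\<close>

lemma generic_representation_exists: "orthogonal_reps T \<inter> generic T \<noteq> {}"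
proof (induction T rule: finite_induct[OF finite])
  case 1
  have "0 \<in> orthogonal_reps {} \<inter> generic {}"
    using subspace by (auto simp: orthogonal_reps_def generic_def independent_family_def subspace_0 independent_empty)
  thus ?case by blast
next
  case (2 v T)
  then obtain x where x: "x \<in> orthogonal_reps T" "x \<in> generic T" by blast
  define y :: "'a^'n" where "y = (\<chi> i. if i = v then 0 else x $ i)"
  have "y \<in> orthogonal_reps (insert v T)"
    using x(1) subspace by (auto simp: orthogonal_reps_def y_def subspace_0)
  moreover have "y \<in> generic (insert v T - {v})"
    by (rule generic_cong[of x]) (use x(2) 2 in \<open>auto simp: y_def\<close>)
  ultimately have "y \<in> closure (orthogonal_reps (insert v T) \<inter> generic (insert v T))"
    using generic_dense[of v "insert v T"] by blast
  thus ?case by (metis closure_empty empty_iff)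
qed

end

section \<open>Rank, spark and columns of symmetric matrices\<close>

lemma column_in_columns: "column j A \<in> columns A"
  by (auto simp: columns_def)

lemma columns_independent_card_le_rank:
  "columns_independent A S \<Longrightarrow> card S \<le> rank A"
  unfolding columns_independent_iff_family column_rank_def
  by (rule independent_family_card_le_dim) (auto simp: column_in_columns)

lemma columns_independent_mono:
  "columns_independent A S \<Longrightarrow> T \<subseteq> S \<Longrightarrow> columns_independent A T"
  unfolding columns_independent_iff_family by (rule independent_family_mono)

lemma columns_independent_UNIV_iff:
  fixes A :: "real^'n^'n"
  shows "columns_independent A UNIV \<longleftrightarrow> invertible A"
  unfolding columns_independent_iff_family independent_family_iff[OF finite]
    invertible_left_inverse matrix_left_invertible_independent_columns
  by (simp add: scalar_mult_eq_scaleR)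

lemma spark_eq_Suc_rank:
  fixes A :: "real^'n^'n"
  assumes ind: "\<And>S. card S \<le> rank A \<Longrightarrow> columns_independent A S"
  shows "spark A = rank A + 1"
proof (cases "invertible A")
  case True
  hence "CARD('n) \<le> rank A"
    using columns_independent_card_le_rank[of A UNIV] columns_independent_UNIV_iff[of A] by simp
  hence "rank A = CARD('n)" using rank_bound[of A] by simp
  thus ?thesis using True by (simp add: spark_def)
next
  case False
  hence "\<not> CARD('n) \<le> rank A" using ind[of UNIV] columns_independent_UNIV_iff[of A] by auto
  hence "rank A + 1 \<le> CARD('n)" by simp
  then obtain S :: "'n set" where S: "card S = rank A + 1"
    by (metis obtain_subset_with_card_n)
  have "(LEAST s. \<exists>S. card S = s \<and> \<not> columns_independent A S) = rank A + 1"
  proof (rule Least_equality)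
    show "\<exists>S. card S = rank A + 1 \<and> \<not> columns_independent A S"
      using S columns_independent_card_le_rank[of A S] by auto
    show "rank A + 1 \<le> s" if "\<exists>S. card S = s \<and> \<not> columns_independent A S" for s
      using that ind by (metis Suc_eq_plus1 not_less_eq_eq)
  qed
  thus ?thesis using False by (simp add: spark_def)
qed

text \<open>
  For an invertible matrix the value \<open>CARD('n) + 1\<close> of the spark makes the bound vacuous, and
  indeed all columns are independent.
\<close>

lemma columns_independent_below_spark:
  fixes A :: "real^'n^'n"
  assumes "card S < spark A"
  shows "columns_independent A S"
proof (cases "invertible A")
  case True
  thus ?thesis using columns_independent_UNIV_iff[of A] columns_independent_mono by blast
next
  case False
  thus ?thesis using assms not_less_Least[of "card S"] by (auto simp: spark_def)
qed

text \<open>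
  If \<open>rank A\<close> independent columns vanish in a row, they span the column space, so the whole row
  vanishes.
\<close>

lemma row_zero_of_zero_on_basis:
  assumes ind: "columns_independent A Z" and card: "card Z = rank A"
    and zero: "\<And>z. z \<in> Z \<Longrightarrow> A $ v $ z = 0"
  shows "A $ v $ w = 0"
proof -
  have inj: "inj_on (\<lambda>j. column j A) Z" and indep: "independent ((\<lambda>j. column j A) ` Z)"
    using ind by (auto simp: columns_independent_def)
  have "columns A \<subseteq> span ((\<lambda>j. column j A) ` Z)"
    by (rule card_ge_dim_independent)
      (use indep card in \<open>auto simp: column_in_columns card_image[OF inj] column_rank_def\<close>)
  hence "column w A \<in> span ((\<lambda>j. column j A) ` Z)" using column_in_columns by blast
  hence "column w A $ v = 0"
    by (induction rule: span_induct_alt) (auto simp: column_def zero)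
  thus ?thesis by (simp add: column_def)
qed

text \<open>
  The row of \<open>v\<close> vanishes at the non-neighbors of \<open>v\<close> but not at its neighbors, so it has fewer
  than \<open>rank A\<close> non-neighbors if any \<open>rank A\<close> columns are independent.
\<close>

lemma card_closed_non_neighbors_le_rank:
  assumes simple: "simple_graph adj" and A: "A \<in> sym_matrices adj" and iso: "\<not> isolated_vertex adj v"
    and ind: "\<And>S. card S = rank A \<Longrightarrow> columns_independent A S"
  shows "card (insert v (non_neighbors adj v)) \<le> rank A"
proof (rule ccontr)
  assume "\<not> card (insert v (non_neighbors adj v)) \<le> rank A"
  hence "rank A \<le> card (non_neighbors adj v)"
    by (auto simp: non_neighbors_def)
  then obtain Z where Z: "Z \<subseteq> non_neighbors adj v" "card Z = rank A"
    by (metis obtain_subset_with_card_n)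
  obtain w where w: "adj v w" using iso by (auto simp: isolated_vertex_def)
  have off: "A $ i $ j \<noteq> 0 \<longleftrightarrow> adj i j" if "i \<noteq> j" for i j
    using A that by (auto simp: sym_matrices_def)
  have "A $ v $ z = 0" if "z \<in> Z" for z
    using off[of v z] that Z(1) by (auto simp: non_neighbors_def)
  hence "A $ v $ w = 0"
    using row_zero_of_zero_on_basis[of A Z v w] A ind Z(2) by (auto simp: sym_matrices_def)
  moreover have "v \<noteq> w" using w simple by (auto simp: simple_graph_def irreflp_def)
  ultimately show False using off w by blast
qed

text \<open>
  By symmetry the rows of \<open>D\<close> are independent, so the column space contains
  vectors \<open>A *v t i\<close> whose restrictions to \<open>D\<close> are the unit vectors. The columns of \<open>C\<close> vanish
  on \<open>D\<close>, so together with these vectors they form an independent family. Without positive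
  semidefiniteness the columns of \<open>C\<close> and \<open>D\<close> themselves could be dependent.
\<close>

lemma card_separated_le_rank:
  fixes A :: "real^'n^'n"
  assumes ind: "columns_independent A C" "columns_independent A D"
    and disj: "C \<inter> D = {}" and zero: "\<And>i j. i \<in> D \<Longrightarrow> j \<in> C \<Longrightarrow> A $ i $ j = 0"
    and sym: "transpose A = A"
  shows "card (C \<union> D) \<le> rank A"
proof -
  have "\<exists>t. \<forall>j\<in>D. t \<bullet> column j A = (if j = i then 1 else 0)" for i
    using exists_dual_vector[of "\<lambda>j. column j A" D "\<lambda>j. if j = i then 1 else 0"] ind(2)
    unfolding columns_independent_iff_family by metis
  then obtain t where t: "\<And>i j. j \<in> D \<Longrightarrow> t i \<bullet> column j A = (if j = i then 1 else 0)"
    by metis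
  have row: "(A *v t i) $ j = (if j = i then 1 else 0)" if "j \<in> D" for i j
  proof -
    have "column j A = row j A" using sym by (metis column_transpose)
    thus ?thesis using t[OF that, of i]
      by (simp add: matrix_vector_mul_component row_def inner_commute vec_lambda_eta)
  qed
  define b where "b = (\<lambda>i. if i \<in> C then column i A else A *v t i)"
  have "independent_family b (C \<union> D)"
    unfolding independent_family_iff[OF finite]
  proof (intro allI impI)
    fix c assume 0: "(\<Sum>i\<in>C \<union> D. c i *\<^sub>R b i) = 0"
    have D: "c j = 0" if j: "j \<in> D" for j
    proof -
      have "0 = (\<Sum>i\<in>C \<union> D. c i *\<^sub>R b i) $ j" using 0 by simp
      also have "\<dots> = (\<Sum>i\<in>C \<union> D. c i * (if j = i then 1 else 0))"
        unfolding sum_component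
        by (rule sum.cong) (use j disj zero row in \<open>auto simp: b_def column_def\<close>)
      also have "\<dots> = c j" using j by (simp add: if_distrib cong: if_cong)
      finally show ?thesis by simp
    qed
    have "(\<Sum>i\<in>C. c i *\<^sub>R column i A) = (\<Sum>i\<in>C \<union> D. c i *\<^sub>R b i)"
      by (rule sum.mono_neutral_cong_left) (auto simp: b_def D)
    hence "\<forall>i\<in>C. c i = 0"
      using 0 ind(1) by (simp add: columns_independent_iff_family independent_family_iff)
    thus "\<forall>i\<in>C \<union> D. c i = 0" using D by blast
  qed
  hence "card (C \<union> D) \<le> dim (span (columns A))"
    by (rule independent_family_card_le_dim)
      (auto simp: b_def matrix_vector_mult_in_columnspace column_in_columns span_base)
  thus ?thesis by (simp add: column_rank_def)
qed

text \<open>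
  If \<open>T\<close> falls apart into \<open>C\<close> and \<open>D\<close>, then \<open>C\<close> consists of non-neighbors of any vertex of \<open>D\<close> and
  conversely, so both column sets are independent and the rank bounds the size of \<open>T\<close>.
\<close>

lemma large_connected_of_columns_independent:
  assumes A: "A \<in> sym_matrices adj" and T: "rank A < card T"
    and ind: "\<And>v. columns_independent A (non_neighbors adj v)"
  shows "connected_induced adj T"
proof (rule ccontr)
  define R where "R = (\<lambda>x y. x \<in> T \<and> y \<in> T \<and> adj x y)"
  assume "\<not> connected_induced adj T"
  then obtain u v where uv: "u \<in> T" "v \<in> T" "\<not> R\<^sup>*\<^sup>* u v"
    by (auto simp: connected_induced_def R_def)
  have sym: "transpose A = A" and off: "\<And>i j. i \<noteq> j \<Longrightarrow> A $ i $ j \<noteq> 0 \<longleftrightarrow> adj i j"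
    using A by (auto simp: sym_matrices_def)
  have Asym: "A $ i $ j = A $ j $ i" for i j
    using arg_cong[OF sym, of "\<lambda>B. B $ j $ i"] by (simp add: transpose_def)
  define C where "C = {w \<in> T. R\<^sup>*\<^sup>* u w}"
  define D where "D = T - C"
  have no_edge: "\<not> adj i j" "\<not> adj j i" "i \<noteq> j" if "i \<in> C" "j \<in> D" for i j
  proof -
    show ij: "i \<noteq> j" using that by (auto simp: D_def)
    show n: "\<not> adj i j"
    proof
      assume "adj i j"
      hence "R i j" using that by (auto simp: C_def D_def R_def)
      thus False using that by (auto simp: C_def D_def intro: rtranclp.rtrancl_into_rtrancl)
    qed
    thus "\<not> adj j i" using off[of i j] off[of j i] Asym[of i j] ij by auto
  qed
  have "u \<in> C" "v \<in> D" using uv by (auto simp: C_def D_def)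
  hence "C \<subseteq> non_neighbors adj v" "D \<subseteq> non_neighbors adj u"
    using no_edge by (force simp: non_neighbors_def)+
  hence "columns_independent A C" "columns_independent A D"
    using ind columns_independent_mono by blast+
  moreover have "A $ i $ j = 0" if "i \<in> D" "j \<in> C" for i j
    using off[of i j] no_edge[OF that(2,1)] by blast
  ultimately have "card (C \<union> D) \<le> rank A"
    using sym by (intro card_separated_le_rank) (auto simp: D_def)
  moreover have "C \<union> D = T" by (auto simp: C_def D_def)
  ultimately show False using T by simp
qed

section \<open>Vertex connectivity and the characterization\<close>

text \<open>
  Vertex sets of more than \<open>k\<close> vertices are the complements of those of fewer than \<open>n - k\<close>,
  and in a complete graph every induced subgraph is connected.
\<close>

lemma m_connected_iff_large_connected:
  fixes adj :: "'n::finite \<Rightarrow> 'n \<Rightarrow> bool"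
  assumes "1 \<le> k" "k \<le> CARD('n)"
  shows "m_connected (CARD('n) - k) adj \<longleftrightarrow> (\<forall>T. k < card T \<longrightarrow> connected_induced adj T)"
proof (cases "complete_graph adj")
  case True
  have "connected_induced adj T" for T
    unfolding connected_induced_def
  proof (intro ballI)
    fix u v assume "u \<in> T" "v \<in> T"
    thus "(\<lambda>x y. x \<in> T \<and> y \<in> T \<and> adj x y)\<^sup>*\<^sup>* u v"
      using True by (cases "u = v") (auto simp: complete_graph_def intro!: r_into_rtranclp)
  qed
  thus ?thesis using True assms by (auto simp: m_connected_def vertex_connectivity_def)
next
  case False
  define P where "P = (\<lambda>m. \<exists>S. card S = m \<and> \<not> connected_induced adj (- S))"
  obtain u v where uv: "u \<noteq> v" "\<not> adj u v" using False by (auto simp: complete_graph_def)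
  have "\<not> connected_induced adj {u, v}"
  proof
    assume "connected_induced adj {u, v}"
    hence "(\<lambda>x y. x \<in> {u, v} \<and> y \<in> {u, v} \<and> adj x y)\<^sup>*\<^sup>* u v" by (simp add: connected_induced_def)
    hence "v = u" by (induction rule: rtranclp_induct) (use uv in auto)
    thus False using uv by simp
  qed
  hence ex: "\<exists>m. P m" unfolding P_def by (metis double_complement)
  have conn: "vertex_connectivity adj = Least P"
    using False by (simp add: vertex_connectivity_def P_def)
  have card: "card (- T) = CARD('n) - card T" for T :: "'n set"
    by (simp add: Compl_eq_Diff_UNIV card_Diff_subset)
  show ?thesis
  proof
    assume "m_connected (CARD('n) - k) adj"
    hence le: "CARD('n) - k \<le> Least P" by (simp add: m_connected_def conn)
    show "\<forall>T. k < card T \<longrightarrow> connected_induced adj T"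
    proof (intro allI impI, rule ccontr)
      fix T assume T: "k < card T" "\<not> connected_induced adj T"
      hence "P (card (- T))" unfolding P_def by (metis double_complement)
      hence "CARD('n) - k \<le> CARD('n) - card T" using le Least_le[of P] card[of T] by fastforce
      moreover have "card T \<le> CARD('n)" by (rule card_mono) auto
      ultimately show False using T(1) by linarith
    qed
  next
    assume large: "\<forall>T. k < card T \<longrightarrow> connected_induced adj T"
    obtain S where S: "card S = Least P" "\<not> connected_induced adj (- S)"
      using LeastI_ex[OF ex] unfolding P_def by blast
    hence "\<not> k < CARD('n) - card S" using large card[of S] by metis
    thus "m_connected (CARD('n) - k) adj" using S(1) by (simp add: m_connected_def conn)
  qed
qed

text \<open>
  The Gram matrix of a generic orthogonal representation: a linear relation between its columns
  is one between the vectors, since a combination of the vectors that is orthogonal to all of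
  them is zero.
\<close>

lemma exists_sym_matrix_with_independent_columns:
  fixes adj :: "'n::finite \<Rightarrow> 'n \<Rightarrow> bool"
  assumes simple: "simple_graph adj" and k: "1 \<le> k" "k \<le> CARD('n)"
    and conn: "\<And>T. k < card T \<Longrightarrow> connected_induced adj T"
  obtains A where "A \<in> sym_matrices adj" "rank A = k"
    "\<And>S. card S \<le> k \<Longrightarrow> columns_independent A S"
proof -
  have "k \<le> dim (UNIV :: (real^'n) set)" using k by simp
  then obtain W :: "(real^'n) set" where W: "subspace W" "dim W = k"
    by (metis choose_subspace_of_subspace)
  interpret connectivity_and_space adj W
    using simple W k conn by unfold_locales auto
  obtain x where x: "x \<in> orthogonal_reps UNIV" "x \<in> generic UNIV"
    using generic_representation_exists by blast
  define A :: "real^'n^'n" where "A = (\<chi> i j. x $ i \<bullet> x $ j)"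
  define L :: "real^'n \<Rightarrow> real^'n" where "L = (\<lambda>y. \<chi> i. x $ i \<bullet> y)"
  have L: "linear L"
    by (rule linearI) (auto simp: L_def vec_eq_iff inner_add_right)
  have col: "column j A = L (x $ j)" for j
    by (simp add: column_def A_def L_def)
  have xW: "x $ i \<in> W" for i using x(1) by (auto simp: orthogonal_reps_def)
  have mem: "A \<in> sym_matrices adj"
  proof -
    have "transpose A = A" by (simp add: A_def transpose_def vec_eq_iff inner_commute)
    moreover have "A $ i $ j \<noteq> 0 \<longleftrightarrow> adj i j" if "i \<noteq> j" for i j
      using x that by (auto simp: A_def orthogonal_reps_def generic_def)
    ultimately show ?thesis by (simp add: sym_matrices_def)
  qed
  have ind: "columns_independent A S" if S: "card S \<le> k" for S
    unfolding columns_independent_iff_family independent_family_iff[OF finite]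
  proof (intro allI impI)
    fix c assume 0: "(\<Sum>i\<in>S. c i *\<^sub>R column i A) = 0"
    define p where "p = (\<Sum>i\<in>S. c i *\<^sub>R x $ i)"
    have "L p = 0"
      using 0 by (simp add: p_def col linear_sum[OF L] linear_scale[OF L])
    hence "x $ i \<bullet> p = 0" for i by (simp add: L_def vec_eq_iff)
    hence "p \<bullet> p = 0" by (subst p_def) (simp add: inner_sum_left)
    hence "p = 0" by simp
    moreover have "independent_family (($) x) S"
      using x(2) S W(2) by (simp add: generic_def)
    ultimately show "\<forall>i\<in>S. c i = 0" unfolding p_def independent_family_iff[OF finite] by blast
  qed
  have "columns A \<subseteq> L ` W" using xW col by (auto simp: columns_def)
  hence "rank A \<le> dim (L ` W)" unfolding column_rank_def by (rule dim_subset)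
  also have "\<dots> \<le> k" using dim_image_le[OF L, of W] W(2) by simp
  finally have "rank A \<le> k" .
  moreover obtain S :: "'n set" where "card S = k" using k by (metis obtain_subset_with_card_n)
  hence "k \<le> rank A" using columns_independent_card_le_rank[OF ind, of S] by simp
  ultimately have "rank A = k" by simp
  with mem ind that show ?thesis by blast
qed

theorem theorem4p4:
  fixes adj :: "'n::finite \<Rightarrow> 'n \<Rightarrow> bool" and k :: nat
  assumes "simple_graph adj"
    and "connected_graph adj"
    and "\<forall>v. \<not> isolated_vertex adj v"
    and "1 \<le> k" and "k \<le> CARD('n)"
  defines "P1 \<equiv> m_connected (CARD('n) - k) adj"
    and "P2 \<equiv> \<exists>A\<in>sym_matrices adj. k = rank A \<and> k = spark A - 1"
    and "P3 \<equiv> \<exists>A\<in>sym_matrices adj. k = rank A \<and>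
                 (\<forall>v. columns_independent A (insert v (non_neighbors adj v)))"
    and "P4 \<equiv> \<exists>A\<in>sym_matrices adj. k = rank A \<and>
                 (\<forall>v. columns_independent A (non_neighbors adj v))"
  shows "(P1 \<longleftrightarrow> P2) \<and> (P2 \<longleftrightarrow> P3) \<and> (P3 \<longleftrightarrow> P4)"
proof -
  note P1_iff = m_connected_iff_large_connected[OF assms(4,5), of adj]
  have "P2" if "P1"
  proof -
    have large: "\<And>T. k < card T \<Longrightarrow> connected_induced adj T"
      using that P1_iff unfolding P1_def by blast
    obtain A where A: "A \<in> sym_matrices adj" "rank A = k"
        "\<And>S. card S \<le> k \<Longrightarrow> columns_independent A S"
      using exists_sym_matrix_with_independent_columns[OF assms(1,4,5) large] by blast
    hence "spark A = k + 1" using spark_eq_Suc_rank[of A] by simp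
    thus P2 unfolding P2_def using A by auto
  qed
  moreover have "P3" if "P2"
  proof -
    obtain A where A: "A \<in> sym_matrices adj" "k = rank A" "k = spark A - 1"
      using \<open>P2\<close> unfolding P2_def by blast
    have ind: "columns_independent A S" if "card S \<le> k" for S
      using that A(3) assms(4) by (intro columns_independent_below_spark) simp
    have "card (insert v (non_neighbors adj v)) \<le> k" for v
      using card_closed_non_neighbors_le_rank[OF assms(1) A(1), of v] ind A(2) assms(3) by simp
    thus P3 unfolding P3_def using A ind by blast
  qed
  moreover have "P4" if "P3"
    using that columns_independent_mono[OF _ subset_insertI] unfolding P3_def P4_def by blast
  moreover have "P1" if "P4"
    using that large_connected_of_columns_independent P1_iff unfolding P1_def P4_def by blast
  ultimately show ?thesis by blast
qed

end
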